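(* (a) For every integer $n\ge 1$, there is an automaton $\mathcal{A}_n$ with $n$ states and a number of events that is super-exponential in $n$ (and a suitable set $Q_{NS}$ of nonsecret pairs) such that the observer of the NFA $\mathcal{A}_{NS}$ of Algorithm 2 (the observer-based IFO verification) has $2^{n^2}$ states; hence Algorithm 2 has to make at least $2^{n^2}$ steps. (b) For odd $n$, the worst-case time complexity of Algorithm 2 on $n$-state automata is $\Omega\big(n^2\,2^{(n^2-1)/4}\big)$ even if the automata are over a binary alphabet.
   Context: An automaton is a triple $\mathcal{A}=(Q,\Sigma,\delta)$ with a finite state set $Q$, a finite nonempty alphabet $\Sigma$ (events), and $\delta\colon Q\times\Sigma\to 2^Q$, extended to $2^Q\times\Sigma^*$ as usual. $\mathcal{A}[I,F]$ denotes the NFA that is a copy of $\mathcal{A}$ with initial states $I$ and final states $F$ (a singleton is written as its element). $\Sigma_o\subseteq\Sigma$ is the set of observable events and $P\colon\Sigma^*\to\Sigma_o^*$ is the morphism erasing the unobservable events. IFO: $\mathcal{A}$ is initial-and-final-state opaque (IFO) with respect to sets of secret and nonsecret pairs of states $Q_S,Q_{NS}\subseteq Q\times Q$ and $P$ if for all $(s,t)\in Q_S$ and all $w$ with $t\in\delta(s,w)$ there are $(s',t')\in Q_{NS}$ and $w'$ with $t'\in\delta(s',w')$ and $P(w)=P(w')$. A set $S\subseteq Q\times Q$ of pairs is represented in clustered form as a subset of $Q\times 2^Q$ with at most one pair $(s,T)$ for each $s$, where $T=\{f\mid (s,f)\in S\}$. The disjoint union of automata makes their state sets pairwise disjoint by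 renaming and takes the component-wise union (of states, transitions, initial states and final states). The observer of an NFA is the reachable part of the DFA obtained by the standard subset construction from its projected automaton (the automaton over $\Sigma_o$ with the same states obtained by replacing each transition $(q,a,r)$ by $(q,P(a),r)$ and eliminating $\varepsilon$-transitions). Algorithm 2 (input: $\mathcal{A}$, clustered $Q_S,Q_{NS}\subseteq Q\times 2^Q$, $\Sigma_o$): let $\mathcal{A}_S$ be the disjoint union of $\mathcal{A}[s,T]$ for $(s,T)\in Q_S$; let $\mathcal{A}_{NS}$ be the disjoint union of $\mathcal{A}[s,T]$ for $(s,T)\in Q_{NS}$; compute the observer $\mathcal{A}_{NS}^{obs}$ of $\mathcal{A}_{NS}$; decide whether $P(L_m(\mathcal{A}_S))\subseteq P(L_m(\mathcal{A}_{NS}))$ by testing emptiness of the product of (the projection of) $\mathcal{A}_S$ with the complement of $\mathcal{A}_{NS}^{obs}$, and return the answer. Constructing each state of the observer costs at least one step. A function $f(n)$ is super-exponential if $\lim_{n\to\infty} f(n)/c^n=\infty$ for every constant $c>1$. *)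

theory Defs
  imports Complex_Main "HOL-Library.Extended_Real"
begin

record ('q, 'e) automaton =
  states :: "'q set"
  events :: "'e set"
  trans  :: "'q \<Rightarrow> 'e \<Rightarrow> 'q set"

record ('q, 'e) nfa = "('q, 'e) automaton" +
  initial :: "'q set"
  final   :: "'q set"

record ('q, 'e) dfa =
  dstates :: "'q set"
  devents :: "'e set"
  dtrans  :: "'q \<Rightarrow> 'e \<Rightarrow> 'q"
  dinit   :: "'q"
  dfinal  :: "'q set"

definition wf_automaton :: "('q, 'e, 'z) automaton_scheme \<Rightarrow> bool" where
  "wf_automaton A \<longleftrightarrow>
     finite (states A) \<and> finite (events A) \<and> events A \<noteq> {} \<and>
     (\<forall>q\<in>states A. \<forall>a\<in>events A. trans A q a \<subseteq> states A)"

primrec delta :: "('q, 'e, 'z) automaton_scheme \<Rightarrow> 'q set \<Rightarrow> 'e list \<Rightarrow> 'q set" where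
  "delta A X [] = X"
| "delta A X (a # w) = delta A (\<Union>q\<in>X. trans A q a) w"

definition with_init_final ::
  "('q, 'e) automaton \<Rightarrow> 'q set \<Rightarrow> 'q set \<Rightarrow> ('q, 'e) nfa" where
  "with_init_final A I F =
     \<lparr>states = states A, events = events A, trans = trans A, initial = I, final = F\<rparr>"

definition marked_lang :: "('q, 'e) nfa \<Rightarrow> 'e list set" where
  "marked_lang N = {w \<in> lists (events N). delta N (initial N) w \<inter> final N \<noteq> {}}"

definition erase :: "'e set \<Rightarrow> 'e list \<Rightarrow> 'e list" where
  "erase Sigma_o w = filter (\<lambda>a. a \<in> Sigma_o) w"

definition IFO ::
  "('q, 'e) automaton \<Rightarrow> ('q \<times> 'q) set \<Rightarrow> ('q \<times> 'q) set \<Rightarrow> 'e set \<Rightarrow> bool" where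
  "IFO A QS QNS Sigma_o \<longleftrightarrow>
     (\<forall>(s, t)\<in>QS. \<forall>w\<in>lists (events A). t \<in> delta A {s} w \<longrightarrow>
        (\<exists>(s', t')\<in>QNS. \<exists>w'\<in>lists (events A).
           t' \<in> delta A {s'} w' \<and> erase Sigma_o w = erase Sigma_o w'))"

text \<open>
  The set \<open>C\<close> represents the set \<open>S\<close> of pairs of states in clustered form.  Each state \<open>s\<close>
  has at most one cluster because \<open>T\<close> is determined by \<open>s\<close>; clusters with empty \<open>T\<close>
  are allowed.
\<close>

definition clustered_form ::
  "('q, 'e) automaton \<Rightarrow> ('q \<times> 'q) set \<Rightarrow> ('q \<times> 'q set) set \<Rightarrow> bool" where
  "clustered_form A S C \<longleftrightarrow>
     S \<subseteq> states A \<times> states A \<and> C \<subseteq> states A \<times> Pow (states A) \<and>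
     Domain S \<subseteq> Domain C \<and> (\<forall>(s, T)\<in>C. T = {f. (s, f) \<in> S})"

text \<open>
  States are renamed by tagging them with the index of their component.  The alphabet is a
  parameter, since all components share it and the family may be empty.
\<close>

definition disjoint_union :: "'e set \<Rightarrow> 'i set \<Rightarrow> ('i \<Rightarrow> ('q, 'e) nfa) \<Rightarrow> ('i \<times> 'q, 'e) nfa" where
  "disjoint_union E J N =
     \<lparr>states = (SIGMA i:J. states (N i)),
      events = E,
      trans = (\<lambda>(i, q) a. {i} \<times> trans (N i) q a),
      initial = (SIGMA i:J. initial (N i)),
      final = (SIGMA i:J. final (N i))\<rparr>"

definition eps_closure :: "('q, 'e) nfa \<Rightarrow> 'e set \<Rightarrow> 'q set \<Rightarrow> 'q set" where
  "eps_closure N Sigma_o X =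
     {(q, r). \<exists>a\<in>events N - Sigma_o. r \<in> trans N q a}\<^sup>* `` X"

text \<open>
  The initial states are closed under unobservable transitions, so that the empty
  observation is handled without changing the final states.
\<close>

definition projected :: "('q, 'e) nfa \<Rightarrow> 'e set \<Rightarrow> ('q, 'e) nfa" where
  "projected N Sigma_o =
     \<lparr>states = states N,
      events = Sigma_o,
      trans = (\<lambda>q a. eps_closure N Sigma_o
                 (\<Union>p\<in>eps_closure N Sigma_o {q}. trans N p a)),
      initial = eps_closure N Sigma_o (initial N),
      final = final N\<rparr>"

definition subset_construction :: "('q, 'e) nfa \<Rightarrow> ('q set, 'e) dfa" where
  "subset_construction N =
     \<lparr>dstates = Pow (states N),
      devents = events N,
      dtrans = (\<lambda>X a. \<Union>q\<in>X. trans N q a),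
      dinit = initial N,
      dfinal = {X \<in> Pow (states N). X \<inter> final N \<noteq> {}}\<rparr>"

inductive_set reachable_states :: "('q, 'e) dfa \<Rightarrow> 'q set" for D where
  init: "dinit D \<in> reachable_states D"
| step: "q \<in> reachable_states D \<Longrightarrow> a \<in> devents D \<Longrightarrow> dtrans D q a \<in> reachable_states D"

definition reachable_part :: "('q, 'e) dfa \<Rightarrow> ('q, 'e) dfa" where
  "reachable_part D =
     D\<lparr>dstates := dstates D \<inter> reachable_states D, dfinal := dfinal D \<inter> reachable_states D\<rparr>"

definition observer :: "('q, 'e) nfa \<Rightarrow> 'e set \<Rightarrow> ('q set, 'e) dfa" where
  "observer N Sigma_o = reachable_part (subset_construction (projected N Sigma_o))"

definition complement :: "('q, 'e) dfa \<Rightarrow> ('q, 'e) dfa" where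
  "complement D = D\<lparr>dfinal := dstates D - dfinal D\<rparr>"

definition product :: "('p, 'e) nfa \<Rightarrow> ('q, 'e) dfa \<Rightarrow> ('p \<times> 'q, 'e) nfa" where
  "product N D =
     \<lparr>states = states N \<times> dstates D,
      events = events N \<inter> devents D,
      trans = (\<lambda>(p, q) a. trans N p a \<times> {dtrans D q a}),
      initial = initial N \<times> {dinit D},
      final = final N \<times> dfinal D\<rparr>"

type_synonym ('q, 'e) alg2_input =
  "('q, 'e) automaton \<times> ('q \<times> 'q set) set \<times> ('q \<times> 'q set) set \<times> 'e set"

definition alg2_inputs :: "('q, 'e) alg2_input set" where
  "alg2_inputs = {(A, CS, CNS, Sigma_o).
     wf_automaton A \<and> Sigma_o \<subseteq> events A \<and>
     (\<exists>QS. clustered_form A QS CS) \<and> (\<exists>QNS. clustered_form A QNS CNS)}"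

definition cluster_nfa ::
  "('q, 'e) automaton \<Rightarrow> ('q \<times> 'q set) set \<Rightarrow> (('q \<times> 'q set) \<times> 'q, 'e) nfa" where
  "cluster_nfa A C =
     disjoint_union (events A) C (\<lambda>(s, T). with_init_final A {s} T)"

definition alg2_observer ::
  "('q, 'e) alg2_input \<Rightarrow> ((('q \<times> 'q set) \<times> 'q) set, 'e) dfa" where
  "alg2_observer = (\<lambda>(A, CS, CNS, Sigma_o). observer (cluster_nfa A CNS) Sigma_o)"

definition alg2_answer :: "('q, 'e) alg2_input \<Rightarrow> bool" where
  "alg2_answer = (\<lambda>(A, CS, CNS, Sigma_o).
     marked_lang (product (projected (cluster_nfa A CS) Sigma_o)
       (complement (alg2_observer (A, CS, CNS, Sigma_o)))) = {})"

text \<open>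
  A function from inputs to answers and numbers of steps describes executions of the
  algorithm.  The only commitment about costs is that constructing each state of the
  observer takes at least one step.
\<close>

definition executes_alg2 :: "(('q, 'e) alg2_input \<Rightarrow> bool \<times> nat) \<Rightarrow> bool" where
  "executes_alg2 run \<longleftrightarrow>
     (\<forall>x\<in>alg2_inputs. fst (run x) = alg2_answer x \<and>
                      card (dstates (alg2_observer x)) \<le> snd (run x))"

text \<open>
  The supremum is taken in the extended reals, as the number of steps is not assumed to be
  bounded on the inputs with a given number of states.
\<close>

definition worst_case_steps ::
  "(('q, 'e) alg2_input \<Rightarrow> bool \<times> nat) \<Rightarrow> ('q, 'e) alg2_input set \<Rightarrow> ereal" where
  "worst_case_steps run X = (SUP x\<in>X. ereal (real (snd (run x))))"

definition binary_inputs :: "nat \<Rightarrow> ('q, 'e) alg2_input set" where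
  "binary_inputs n = {(A, CS, CNS, Sigma_o) \<in> alg2_inputs.
     card (states A) = n \<and> card (events A) = 2}"

definition super_exponential :: "(nat \<Rightarrow> real) \<Rightarrow> bool" where
  "super_exponential f \<longleftrightarrow> (\<forall>c>1. filterlim (\<lambda>n. f n / c ^ n) at_top sequentially)"

text \<open>
  The algorithm as defined above decides IFO, see \<open>alg2_answer_iff_IFO\<close>.
\<close>


lemma delta_Un: "delta A X w = (\<Union>q\<in>X. delta A {q} w)"
proof (induction w arbitrary: X)
  case (Cons a w)
  show ?case by (simp, subst Cons, subst (2) Cons, auto)
qed auto

lemma delta_mono: "X \<subseteq> Y \<Longrightarrow> delta A X w \<subseteq> delta A Y w"
  by (subst delta_Un, subst (2) delta_Un) (rule UN_mono, auto)

lemma delta_snoc: "delta A X (w @ [a]) = (\<Union>q\<in>delta A X w. trans A q a)"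
  by (induction w arbitrary: X) auto

lemma delta_append: "delta A X (u @ w) = delta A (delta A X u) w"
  by (induction u arbitrary: X) auto

lemma eps_eq: "eps_closure N So X = (\<Union>u\<in>lists (events N - So). delta N X u)" (is "?L = ?R")
proof
  let ?r = "{(q, r). \<exists>a\<in>events N - So. r \<in> trans N q a}"
  show "?L \<subseteq> ?R"
  proof
    fix y assume "y \<in> ?L"
    then obtain x where x: "x \<in> X" "(x, y) \<in> ?r\<^sup>*" unfolding eps_closure_def by auto
    from x(2) show "y \<in> ?R"
    proof (induction rule: rtrancl_induct)
      case base
      show ?case using x(1) by (intro UN_I[of "[]"]) auto
    next
      case (step y z)
      then obtain u a where "u \<in> lists (events N - So)" "y \<in> delta N X u" "a \<in> events N - So" "z \<in> trans N y a"
        by auto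
      then show ?case by (intro UN_I[of "u @ [a]"]) (auto simp: delta_snoc)
    qed
  qed
  show "?R \<subseteq> ?L"
  proof
    fix y assume "y \<in> ?R"
    then obtain u where u: "u \<in> lists (events N - So)" "y \<in> delta N X u" by auto
    from u show "y \<in> ?L"
    proof (induction u arbitrary: y rule: rev_induct)
      case Nil then show ?case by (auto simp: eps_closure_def)
    next
      case (snoc a u)
      then obtain q where q: "q \<in> delta N X u" "y \<in> trans N q a" "a \<in> events N - So" by (auto simp: delta_snoc)
      have "q \<in> ?L" using snoc q by auto
      then show ?case using q(2,3) unfolding eps_closure_def
        by (auto intro: rtrancl_into_rtrancl)
    qed
  qed
qed

lemma eps_Un: "eps_closure N So (\<Union>i\<in>J. X i) = (\<Union>i\<in>J. eps_closure N So (X i))"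
  by (auto simp: eps_closure_def)

lemma eps_single: "eps_closure N So X = (\<Union>q\<in>X. eps_closure N So {q})"
  by (auto simp: eps_closure_def)

lemma filter_app: "filter P w = v @ z \<Longrightarrow> \<exists>us vs. w = us @ vs \<and> filter P us = v \<and> filter P vs = z"
proof (induction v arbitrary: w)
  case (Cons b v)
  then obtain p s where p: "w = p @ b # s" "\<forall>x\<in>set p. \<not> P x" "P b" "filter P s = v @ z"
    by (auto simp: filter_eq_Cons_iff)
  obtain us vs where "s = us @ vs" "filter P us = v" "filter P vs = z" using Cons.IH[OF p(4)] by blast
  then show ?case using p by (intro exI[of _ "p @ b # us"] exI[of _ vs]) (auto simp: filter_empty_conv)
next
  case Nil then show ?case by (intro exI[of _ "[]"] exI[of _ w]) auto
qed

lemma delta_proj: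
  assumes "So \<subseteq> events N" "v \<in> lists So"
  shows "delta (projected N So) (eps_closure N So X) v = (\<Union>w\<in>{w\<in>lists (events N). erase So w = v}. delta N X w)"
  using assms(2)
proof (induction v rule: rev_induct)
  case Nil
  have "{w\<in>lists (events N). erase So w = []} = lists (events N - So)"
    by (auto simp: erase_def filter_empty_conv in_lists_conv_set)
  then show ?case by (simp add: eps_eq)
next
  case (snoc a v)
  have IH: "delta (projected N So) (eps_closure N So X) v = (\<Union>w\<in>{w\<in>lists (events N). erase So w = v}. delta N X w)"
    using snoc by auto
  have a: "a \<in> So" using snoc by auto
  let ?D = "\<Union>w\<in>{w\<in>lists (events N). erase So w = v}. delta N X w"
  have cl: "eps_closure N So ?D = ?D"
  proof
    show "eps_closure N So ?D \<subseteq> ?D"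
    proof
      fix y assume "y \<in> eps_closure N So ?D"
      then obtain u where u: "u \<in> lists (events N - So)" "y \<in> delta N ?D u" by (auto simp: eps_eq)
      obtain q where "q \<in> ?D" "y \<in> delta N {q} u" using u(2) by (subst (asm) delta_Un) auto
      then obtain w where "w \<in> lists (events N)" "erase So w = v" "q \<in> delta N X w" "y \<in> delta N {q} u" by auto
      moreover have "y \<in> delta N X (w @ u)" using calculation unfolding delta_append
        by (subst delta_Un) auto
      moreover have "erase So (w @ u) = v" using calculation(2) u(1)
        by (auto simp: erase_def filter_empty_conv in_lists_conv_set)
      moreover have "w @ u \<in> lists (events N)" using calculation(1) u(1) by auto
      ultimately show "y \<in> ?D" by blast
    qed
    show "?D \<subseteq> eps_closure N So ?D" by (auto simp: eps_closure_def)
  qed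
  have "delta (projected N So) (eps_closure N So X) (v @ [a]) =
     eps_closure N So (\<Union>p\<in>eps_closure N So ?D. trans N p a)"
    unfolding delta_snoc IH
  proof -
    have "(\<Union>p\<in>eps_closure N So ?D. trans N p a) = (\<Union>q\<in>?D. \<Union>p\<in>eps_closure N So {q}. trans N p a)"
      by (subst eps_single) blast
    then show "(\<Union>q\<in>?D. trans (projected N So) q a) = eps_closure N So (\<Union>p\<in>eps_closure N So ?D. trans N p a)"
      by (simp only: eps_Un) (simp add: projected_def eps_Un)
  qed
  also have "\<dots> = eps_closure N So (\<Union>p\<in>?D. trans N p a)" using cl by simp
  also have "\<dots> = (\<Union>w\<in>{w\<in>lists (events N). erase So w = v @ [a]}. delta N X w)" (is "?A = ?B")
  proof
    show "?A \<subseteq> ?B"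
    proof
      fix y assume "y \<in> ?A"
      then obtain u where u: "u \<in> lists (events N - So)" "y \<in> delta N (\<Union>p\<in>?D. trans N p a) u" by (auto simp: eps_eq)
      obtain q where q: "q \<in> (\<Union>p\<in>?D. trans N p a)" "y \<in> delta N {q} u" using u(2) by (subst (asm) delta_Un) auto
      then obtain w where w: "w \<in> lists (events N)" "erase So w = v" "q \<in> delta N X (w @ [a])" by (auto simp: delta_snoc)
      have "y \<in> delta N X ((w @ [a]) @ u)" using w(3) q(2) unfolding delta_append[of _ _ "w @ [a]"]
        by (subst delta_Un) auto
      moreover have "erase So ((w @ [a]) @ u) = v @ [a]" using w(2) u(1) a
        by (auto simp: erase_def filter_empty_conv in_lists_conv_set)
      moreover have "(w @ [a]) @ u \<in> lists (events N)" using w(1) u(1) a assms(1) by auto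
      ultimately show "y \<in> ?B" by blast
    qed
    show "?B \<subseteq> ?A"
    proof
      fix y assume "y \<in> ?B"
      then obtain w where w: "w \<in> lists (events N)" "erase So w = v @ [a]" "y \<in> delta N X w" by auto
      obtain u z where uz: "w = u @ a # z" "filter (\<lambda>a. a \<in> So) u = v" "filter (\<lambda>a. a \<in> So) z = []"
      proof -
        have "filter (\<lambda>a. a \<in> So) w = v @ [a]" using w(2) by (simp add: erase_def)
        then obtain us vs where 1: "w = us @ vs" "filter (\<lambda>a. a \<in> So) us = v" "filter (\<lambda>a. a \<in> So) vs = [a]"
          using filter_app[of "\<lambda>a. a \<in> So" w v "[a]"] by blast
        from 1(3) obtain p s where "vs = p @ a # s" "\<forall>x\<in>set p. x \<notin> So" "filter (\<lambda>a. a \<in> So) s = []"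
          by (auto simp: filter_eq_Cons_iff)
        then show ?thesis using that[of "us @ p" s] 1 by (auto simp: filter_empty_conv)
      qed
      have "y \<in> delta N (\<Union>p\<in>delta N X u. trans N p a) z" using w(3) uz(1) by (simp add: delta_append)
      moreover have "(\<Union>p\<in>delta N X u. trans N p a) \<subseteq> (\<Union>p\<in>?D. trans N p a)"
        using uz w(1) by (auto simp: erase_def)
      ultimately have "y \<in> delta N (\<Union>p\<in>?D. trans N p a) z"
        using delta_mono by (meson subsetD)
      moreover have "z \<in> lists (events N - So)" using uz w(1) by (auto simp: filter_empty_conv in_lists_conv_set)
      ultimately show "y \<in> ?A" by (auto simp: eps_eq)
    qed
  qed
  finally show ?case .
qed

lemma marked_proj:
  assumes "So \<subseteq> events N"
  shows "marked_lang (projected N So) = erase So ` marked_lang N"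
proof -
  have *: "v \<in> lists So \<Longrightarrow> delta (projected N So) (initial (projected N So)) v = (\<Union>w\<in>{w\<in>lists (events N). erase So w = v}. delta N (initial N) w)" for v
    using delta_proj[OF assms, of v "initial N"] by (simp add: projected_def)
  have e: "erase So w \<in> lists So" for w by (auto simp: erase_def)
  have "marked_lang (projected N So) = {v\<in>lists So. (\<Union>w\<in>{w\<in>lists (events N). erase So w = v}. delta N (initial N) w) \<inter> final N \<noteq> {}}"
  proof -
    have f: "events (projected N So) = So" "final (projected N So) = final N" by (auto simp: projected_def)
    show ?thesis unfolding marked_lang_def f by (rule Collect_cong, rule conj_cong, rule refl) (simp only: *)
  qed
  also have "\<dots> = erase So ` marked_lang N" (is "?A = ?B")
  proof (rule set_eqI)
    fix v
    have "v \<in> ?A \<longleftrightarrow> v \<in> lists So \<and> (\<exists>w\<in>lists (events N). erase So w = v \<and> delta N (initial N) w \<inter> final N \<noteq> {})"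
      by auto
    also have "\<dots> \<longleftrightarrow> v \<in> ?B" unfolding marked_lang_def image_iff using e[unfolded in_lists_conv_set]
      by (simp only: mem_Collect_eq Bex_def in_lists_conv_set) metis
    finally show "v \<in> ?A \<longleftrightarrow> v \<in> ?B" .
  qed
  finally show ?thesis .
qed

lemma delta_product: "delta (product N D) (X \<times> {d}) w = delta N X w \<times> {foldl (dtrans D) d w}"
proof (induction w arbitrary: X d)
  case (Cons a w)
  have "(\<Union>q\<in>X \<times> {d}. trans (product N D) q a) = (\<Union>q\<in>X. trans N q a) \<times> {dtrans D d a}"
    by (auto simp: product_def)
  then show ?case using Cons by simp
qed auto

lemma fold_subset: "foldl (dtrans (subset_construction N)) X w = delta N X w"
  by (induction w arbitrary: X) (auto simp: subset_construction_def)

lemma foldl_reach: "w \<in> lists (devents D) \<Longrightarrow> foldl (dtrans D) (dinit D) w \<in> reachable_states D"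
  by (induction w rule: rev_induct) (auto intro: reachable_states.intros)

definition wfn where "wfn N \<longleftrightarrow> initial N \<subseteq> states N \<and> (\<forall>q\<in>states N. \<forall>a\<in>events N. trans N q a \<subseteq> states N)"

lemma wfn_delta: "wfn N \<Longrightarrow> w \<in> lists (events N) \<Longrightarrow> delta N (initial N) w \<subseteq> states N"
  by (induction w rule: rev_induct) (auto simp: wfn_def delta_snoc, blast)

lemma eps_states: 
  assumes "wfn N" "X \<subseteq> states N" shows "eps_closure N So X \<subseteq> states N"
proof
  fix y assume "y \<in> eps_closure N So X"
  then obtain x where "x \<in> X" "(x, y) \<in> {(q, r). \<exists>a\<in>events N - So. r \<in> trans N q a}\<^sup>*"
    by (auto simp: eps_closure_def)
  from this(2,1) show "y \<in> states N" by (induction) (use assms in \<open>auto simp: wfn_def, blast\<close>)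
qed

lemma wfn_proj: assumes "wfn N" "So \<subseteq> events N" shows "wfn (projected N So)"
proof -
  have "eps_closure N So (\<Union>p\<in>eps_closure N So {q}. trans N p a) \<subseteq> states N" if "q \<in> states N" "a \<in> So" for q a
    using eps_states[OF assms(1), of "{q}" So] that assms by (intro eps_states) (auto simp: wfn_def, blast)
  then show ?thesis using assms eps_states[OF assms(1)] unfolding wfn_def by (simp add: projected_def)
qed

lemma product_lang:
  assumes "wfn M" "events N = events M"
  shows "marked_lang (product N (complement (reachable_part (subset_construction M)))) = marked_lang N - marked_lang M"
proof -
  let ?D = "complement (reachable_part (subset_construction M))"
  have s: "dtrans ?D = dtrans (subset_construction M)" "dinit ?D = initial M" "devents ?D = events M"
    by (auto simp: complement_def reachable_part_def subset_construction_def)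
  have fin: "delta M (initial M) w \<in> dfinal ?D \<longleftrightarrow> delta M (initial M) w \<inter> final M = {}" if "w \<in> lists (events M)" for w
  proof -
    have "delta M (initial M) w \<in> reachable_states (subset_construction M)"
      using foldl_reach[of w "subset_construction M"] that fold_subset[of M "initial M" w]
      by (simp add: subset_construction_def)
    then show ?thesis using wfn_delta[OF assms(1) that]
      by (auto simp: complement_def reachable_part_def subset_construction_def)
  qed
  have "delta (product N ?D) (initial (product N ?D)) w = delta N (initial N) w \<times> {delta M (initial M) w}" for w
    using delta_product[of N ?D "initial N" "initial M" w] fold_subset[of M "initial M" w] s
    by (simp add: product_def)
  then have "marked_lang (product N ?D) = {w\<in>lists (events M). (delta N (initial N) w \<times> {delta M (initial M) w}) \<inter> (final N \<times> dfinal ?D) \<noteq> {}}"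
    unfolding marked_lang_def by (simp add: product_def s assms(2))
  also have "\<dots> = marked_lang N - marked_lang M"
  proof -
    have "(w \<in> lists (events M) \<and> (delta N (initial N) w \<times> {delta M (initial M) w}) \<inter> (final N \<times> dfinal ?D) \<noteq> {}) \<longleftrightarrow>
       w \<in> marked_lang N - marked_lang M" for w
    proof (cases "w \<in> lists (events M)")
      case True
      show ?thesis unfolding marked_lang_def assms(2) Times_Int_Times using True fin[OF True] by auto
    qed (simp add: marked_lang_def assms(2))
    then show ?thesis by blast
  qed
  finally show ?thesis .
qed

lemma delta_du: "i \<in> J \<Longrightarrow> delta (disjoint_union E J N) ({i} \<times> X) w = {i} \<times> delta (N i) X w"
proof (induction w arbitrary: X)
  case (Cons a w)
  have "(\<Union>q\<in>{i} \<times> X. trans (disjoint_union E J N) q a) = {i} \<times> (\<Union>q\<in>X. trans (N i) q a)"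
    by (auto simp: disjoint_union_def)
  then show ?case using Cons by simp
qed auto

lemma delta_wif: "delta (with_init_final A I F) X w = delta A X w"
  by (induction w arbitrary: X) (auto simp: with_init_final_def)

lemma cluster_lang: "marked_lang (cluster_nfa A C) = {w\<in>lists (events A). \<exists>(s,T)\<in>C. delta A {s} w \<inter> T \<noteq> {}}"
proof -
  let ?N = "\<lambda>(s, T). with_init_final A {s} T"
  let ?D = "disjoint_union (events A) C ?N"
  have init: "initial ?D = (\<Union>i\<in>C. {i} \<times> initial (?N i))" by (auto simp: disjoint_union_def)
  have "delta ?D (initial ?D) w = (\<Union>i\<in>C. {i} \<times> delta (?N i) (initial (?N i)) w)" for w
  proof -
    have "delta ?D (initial ?D) w = (\<Union>i\<in>C. delta ?D ({i} \<times> initial (?N i)) w)"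
      unfolding init by (subst delta_Un, subst (2) delta_Un) auto
    then show ?thesis by (simp add: delta_du)
  qed
  then have "marked_lang ?D = {w\<in>lists (events A). (\<Union>i\<in>C. {i} \<times> delta (?N i) (initial (?N i)) w) \<inter> (SIGMA i:C. final (?N i)) \<noteq> {}}"
    unfolding marked_lang_def by (simp add: disjoint_union_def)
  also have "\<dots> = {w\<in>lists (events A). \<exists>(s,T)\<in>C. delta A {s} w \<inter> T \<noteq> {}}"
  proof (rule Collect_cong, rule conj_cong, rule refl)
    fix w
    have "(\<Union>i\<in>C. {i} \<times> delta (?N i) (initial (?N i)) w) \<inter> (SIGMA i:C. final (?N i)) \<noteq> {} \<longleftrightarrow>
      (\<exists>i\<in>C. delta (?N i) (initial (?N i)) w \<inter> final (?N i) \<noteq> {})" by blast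
    also have "\<dots> \<longleftrightarrow> (\<exists>(s,T)\<in>C. delta A {s} w \<inter> T \<noteq> {})"
      by (rule bex_cong) (auto simp: delta_wif, auto simp: with_init_final_def)
    finally show "(\<Union>i\<in>C. {i} \<times> delta (?N i) (initial (?N i)) w) \<inter> (SIGMA i:C. final (?N i)) \<noteq> {} \<longleftrightarrow> (\<exists>(s,T)\<in>C. delta A {s} w \<inter> T \<noteq> {})" .
  qed
  finally show ?thesis by (simp add: cluster_nfa_def)
qed

lemma clf: "clustered_form A S C \<Longrightarrow> marked_lang (cluster_nfa A C) = {w\<in>lists (events A). \<exists>(s,t)\<in>S. t \<in> delta A {s} w}"
proof -
  assume c: "clustered_form A S C"
  have "(\<exists>(s,T)\<in>C. D s \<inter> T \<noteq> {}) \<longleftrightarrow> (\<exists>(s,t)\<in>S. t \<in> D s)" for D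
  proof
    assume "\<exists>(s,T)\<in>C. D s \<inter> T \<noteq> {}"
    then obtain s T t where "(s,T) \<in> C" "t \<in> D s" "t \<in> T" by blast
    moreover from this have "T = {f. (s,f) \<in> S}" using c unfolding clustered_form_def by blast
    ultimately show "\<exists>(s,t)\<in>S. t \<in> D s" by blast
  next
    assume "\<exists>(s,t)\<in>S. t \<in> D s"
    then obtain s t where st: "(s,t) \<in> S" "t \<in> D s" by blast
    then obtain T where "(s,T) \<in> C" using c unfolding clustered_form_def by blast
    moreover from this have "T = {f. (s,f) \<in> S}" using c unfolding clustered_form_def by blast
    ultimately show "\<exists>(s,T)\<in>C. D s \<inter> T \<noteq> {}" using st by (intro bexI[of _ "(s,T)"]) auto
  qed
  then show "marked_lang (cluster_nfa A C) = {w\<in>lists (events A). \<exists>(s,t)\<in>S. t \<in> delta A {s} w}"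
    unfolding cluster_lang by (intro Collect_cong conj_cong refl)
qed

theorem alg2_answer_iff_IFO:
  assumes "wf_automaton A" "So \<subseteq> events A" "clustered_form A QS CS" "clustered_form A QNS CNS"
  shows "alg2_answer (A, CS, CNS, So) \<longleftrightarrow> IFO A QS QNS So"
proof -
  have ev: "events (cluster_nfa A C) = events A" for C by (simp add: cluster_nfa_def disjoint_union_def)
  have wf: "wfn (cluster_nfa A CNS)"
  proof -
    have C: "s \<in> states A" if "(s, T) \<in> CNS" for s T using assms(4) that unfolding clustered_form_def by blast
    have t: "r \<in> states A" if "q \<in> states A" "a \<in> events A" "r \<in> trans A q a" for q a r
      using assms(1) that unfolding wf_automaton_def by blast
    show ?thesis unfolding wfn_def cluster_nfa_def disjoint_union_def with_init_final_def
      by (auto intro: C t split: prod.splits)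
  qed
  have "alg2_answer (A, CS, CNS, So) \<longleftrightarrow> marked_lang (projected (cluster_nfa A CS) So) - marked_lang (projected (cluster_nfa A CNS) So) = {}"
    unfolding alg2_answer_def alg2_observer_def observer_def prod.case
    by (subst product_lang) (use wfn_proj[OF wf] assms(2) ev in \<open>auto simp: projected_def\<close>)
  also have "\<dots> \<longleftrightarrow> erase So ` marked_lang (cluster_nfa A CS) \<subseteq> erase So ` marked_lang (cluster_nfa A CNS)"
    using marked_proj[of So "cluster_nfa A CS"] marked_proj[of So "cluster_nfa A CNS"] assms(2) ev by auto
  also have "\<dots> \<longleftrightarrow> IFO A QS QNS So"
    unfolding clf[OF assms(3)] clf[OF assms(4)] IFO_def
    by (simp add: image_iff subset_iff split_beta Ball_def Bex_def) blast
  finally show ?thesis .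
qed
end

(*
  If every pair of states is nonsecret, the observer's states correspond to the relations
  {(s, q). q \<in> delta A {s} w}, that is, to the monoid of binary relations on the states of A that
  the events generate.  For (a) take one event for each relation.
  For (b), let n = 2 m + 1 and split the states into blocks of sizes m and m + 1.  One event rotates
  both blocks, and the other one is the identity plus a single edge from the first block to the
  second.  As m and m + 1 are coprime, the rotations move this edge to each of the m (m + 1)
  positions, hence any set S of edges between the blocks arises together with any of the
  m (m + 1) rotations.
*)
theory Submission
  imports Defs "HOL-Number_Theory.Cong" "HOL-Real_Asymp.Real_Asymp"
begin

section \<open>Observer states as relations generated by words\<close>

text \<open>One copy of the automaton starts in each state, so a reached subset of the disjoint
  union records separately where every start state leads, not merely the union of these
  sets.\<close>

definition full_clusters :: "('q, 'e) automaton \<Rightarrow> ('q \<times> 'q set) set" where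
  "full_clusters A = states A \<times> {states A}"

definition word_relation :: "('q, 'e) automaton \<Rightarrow> 'e list \<Rightarrow> ('q \<times> 'q) set" where
  "word_relation A w = (SIGMA s:states A. delta A {s} w)"

lemma clustered_form_full:
  "clustered_form A (states A \<times> states A) (full_clusters A)"
  by (auto simp: clustered_form_def full_clusters_def)

lemma clustered_form_empty: "clustered_form A {} {}"
  by (simp add: clustered_form_def)

lemma delta_subset_states:
  assumes "wf_automaton A" "w \<in> lists (events A)" "X \<subseteq> states A"
  shows "delta A X w \<subseteq> states A"
  using assms(2,3)
proof (induction w arbitrary: X)
  case (Cons a w)
  then have "(\<Union>q\<in>X. trans A q a) \<subseteq> states A"
    using assms(1) unfolding wf_automaton_def by blast
  with Cons show ?case by simp
qed simp

lemma word_relation_subset: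
  assumes "wf_automaton A" "w \<in> lists (events A)"
  shows "word_relation A w \<subseteq> states A \<times> states A"
proof -
  have "delta A {s} w \<subseteq> states A" if "s \<in> states A" for s
    using that by (intro delta_subset_states[OF assms]) simp
  then show ?thesis unfolding word_relation_def by blast
qed

lemma reachable_states_eq:
  "reachable_states D = (\<lambda>w. foldl (dtrans D) (dinit D) w) ` lists (devents D)"
proof
  show "reachable_states D \<subseteq> (\<lambda>w. foldl (dtrans D) (dinit D) w) ` lists (devents D)"
  proof
    fix x assume "x \<in> reachable_states D"
    then show "x \<in> (\<lambda>w. foldl (dtrans D) (dinit D) w) ` lists (devents D)"
    proof induction
      case init
      show ?case by (rule image_eqI[of _ _ "[]"]) auto
    next
      case (step q a)
      then obtain w where "w \<in> lists (devents D)" "q = foldl (dtrans D) (dinit D) w" by blast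
      with step show ?case by (intro image_eqI[of _ _ "w @ [a]"]) auto
    qed
  qed
qed (auto intro: foldl_reach)

text \<open>With every event observable, the closure under unobservable events is the reflexive
  transitive closure of the empty relation, so projecting changes nothing.\<close>

lemma projected_all_events:
  "projected N (events N) =
     \<lparr>states = states N, events = events N, trans = trans N, initial = initial N, final = final N\<rparr>"
  by (simp add: projected_def eps_closure_def)

lemma delta_cong: "trans A = trans B \<Longrightarrow> delta A X w = delta B X w"
  by (induction w arbitrary: X) auto

text \<open>The component started in \<open>s\<close> evolves exactly as \<open>A\<close> does from
  \<open>{s}\<close>. A subset reached by \<open>w\<close> is therefore
  \<open>word_relation A w\<close> with each pair tagged by its component.\<close>

lemma dstates_observer_full:
  assumes "wf_automaton A"
  shows "dstates (observer (cluster_nfa A (full_clusters A)) (events A)) =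
    (\<lambda>w. (\<lambda>(s, q). ((s, states A), q)) ` word_relation A w) ` lists (events A)"
proof -
  let ?N = "cluster_nfa A (full_clusters A)"
  let ?M = "projected ?N (events A)"
  let ?f = "\<lambda>w. (\<lambda>(s, q). ((s, states A), q)) ` word_relation A w"
  have ev: "events ?N = events A" by (simp add: cluster_nfa_def disjoint_union_def)
  have M: "trans ?M = trans ?N" "states ?M = states ?N" "initial ?M = initial ?N"
    "events ?M = events A"
    using projected_all_events[of ?N] by (simp_all add: ev)
  \<comment> \<open>Splitting the initial set by components lets \<open>delta_du\<close> treat each
    of them on its own.\<close>
  have "initial ?N = (\<Union>s\<in>states A. {(s, states A)} \<times> {s})"
    by (auto simp: cluster_nfa_def disjoint_union_def full_clusters_def with_init_final_def)
  then have init: "delta ?N (initial ?N) w = (\<Union>s\<in>states A. delta ?N ({(s, states A)} \<times> {s}) w)" for w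
    using delta_Un[of ?N "initial ?N" w] by simp
  have step: "delta ?N ({(s, states A)} \<times> {s}) w = {(s, states A)} \<times> delta A {s} w"
    if "s \<in> states A" for s w
    unfolding cluster_nfa_def
    by (subst delta_du) (use that in \<open>auto simp: full_clusters_def delta_wif\<close>)
  have d: "delta ?M (initial ?M) w = ?f w" for w
  proof -
    have "delta ?M (initial ?M) w = delta ?N (initial ?N) w"
      unfolding M(3) using M(1) by (rule delta_cong)
    also have "\<dots> = (\<Union>s\<in>states A. {(s, states A)} \<times> delta A {s} w)"
      unfolding init using step by (rule SUP_cong[OF refl])
    also have "\<dots> = ?f w"
      by (auto simp: word_relation_def)
    finally show ?thesis .
  qed
  have reach: "reachable_states (subset_construction ?M) = ?f ` lists (events A)"
  proof -
    have "dinit (subset_construction ?M) = initial ?M"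
      "devents (subset_construction ?M) = events A"
      using M(4) by (simp_all add: subset_construction_def)
    then show ?thesis
      unfolding reachable_states_eq by (intro image_cong) (simp_all only: fold_subset d)
  qed
  \<comment> \<open>\<open>reachable_part\<close> intersects the reachable sets with the powerset of
    the states; well-formedness ensures that none of them is lost.\<close>
  have "?f w \<subseteq> states ?N" if "w \<in> lists (events A)" for w
    using word_relation_subset[OF assms that]
    by (fastforce simp: cluster_nfa_def disjoint_union_def full_clusters_def with_init_final_def)
  then have "?f ` lists (events A) \<subseteq> Pow (states ?M)"
    unfolding M by blast
  moreover have "dstates (observer ?N (events A)) =
      Pow (states ?M) \<inter> reachable_states (subset_construction ?M)"
    by (simp add: observer_def reachable_part_def) (simp add: subset_construction_def)
  ultimately show ?thesis by (simp only: reach Int_absorb1)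
qed

text \<open>Tagging is injective on pairs, hence its image map is injective on relations, and
  counting observer states amounts to counting relations.\<close>

lemma card_dstates_observer_full:
  fixes A :: "('q, 'e) automaton"
  assumes "wf_automaton A"
  shows "card (dstates (observer (cluster_nfa A (full_clusters A)) (events A))) =
    card (word_relation A ` lists (events A))"
proof -
  have "inj (\<lambda>(s, q). ((s, states A), q))" by (auto simp: inj_def)
  then have "inj_on ((`) (\<lambda>(s, q). ((s, states A), q))) X" for X :: "('q \<times> 'q) set set"
    by (simp add: inj_on_def inj_image_eq_iff)
  then have "card ((`) (\<lambda>(s, q). ((s, states A), q)) ` word_relation A ` lists (events A)) =
      card (word_relation A ` lists (events A))"
    by (rule card_image)
  then show ?thesis
    by (simp only: dstates_observer_full[OF assms] image_image)
qed

lemma executes_alg2_ge_observer: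
  assumes "executes_alg2 run" "wf_automaton A" "Sigma_o \<subseteq> events A"
    "clustered_form A QS CS" "clustered_form A QNS CNS"
  shows "card (dstates (observer (cluster_nfa A CNS) Sigma_o)) \<le> snd (run (A, CS, CNS, Sigma_o))"
proof -
  have "(A, CS, CNS, Sigma_o) \<in> alg2_inputs"
    using assms by (auto simp: alg2_inputs_def)
  then show ?thesis
    using assms(1) unfolding executes_alg2_def by (fastforce simp: alg2_observer_def)
qed

section \<open>One event for each binary relation\<close>

lemma exists_full_relation_automaton:
  "\<exists>A :: (nat, nat) automaton. card (events A) = 2 ^ n\<^sup>2 \<and> wf_automaton A \<and> card (states A) = n \<and>
     card (word_relation A ` lists (events A)) = 2 ^ n\<^sup>2"
proof -
  let ?R = "Pow ({..<n} \<times> {..<n})"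
  have card_R: "card ?R = 2 ^ n\<^sup>2"
    by (simp add: card_Pow card_cartesian_product power2_eq_square)
  \<comment> \<open>Events are natural numbers here, so the relations are numbered.\<close>
  obtain e where e: "bij_betw e {..<(2::nat) ^ n\<^sup>2} ?R"
    using ex_bij_betw_nat_finite[of ?R] card_R by (auto simp: lessThan_atLeast0)
  define A :: "(nat, nat) automaton" where
    "A = \<lparr>states = {..<n}, events = {..<2 ^ n\<^sup>2}, trans = (\<lambda>q a. e a `` {q})\<rparr>"
  have e_sub: "e a \<subseteq> {..<n} \<times> {..<n}" if "a < 2 ^ n\<^sup>2" for a
    using bij_betwE[OF e] that by auto
  have wf: "wf_automaton A"
    using e_sub by (auto simp: wf_automaton_def A_def lessThan_empty_iff)
  have "word_relation A ` lists (events A) = ?R"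
  proof
    show "word_relation A ` lists (events A) \<subseteq> ?R"
      using word_relation_subset[OF wf] by (auto simp: A_def)
    show "?R \<subseteq> word_relation A ` lists (events A)"
    proof
      fix r assume "r \<in> ?R"
      then have "r \<in> e ` {..<2 ^ n\<^sup>2}"
        by (simp only: bij_betw_imp_surj_on[OF e])
      then obtain a where a: "a < 2 ^ n\<^sup>2" "r = e a"
        by (elim imageE) simp
      \<comment> \<open>By \<open>e_sub\<close> all pairs of \<open>e a\<close> start below
        \<open>n\<close>, so restricting to start states in \<open>states A\<close> keeps all of
        \<open>r\<close>.\<close>
      then have "word_relation A [a] = r"
        using e_sub by (auto simp: word_relation_def A_def)
      moreover have "[a] \<in> lists (events A)" using a by (simp add: A_def)
      ultimately show "r \<in> word_relation A ` lists (events A)" by blast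
    qed
  qed
  with wf card_R show ?thesis by (intro exI[of _ A]) (simp add: A_def)
qed

text \<open>The quotient is exp (n^2 ln 2 - n ln c), and the quadratic term dominates for every c >
  1.\<close>

lemma super_exponential_two_power_square: "super_exponential (\<lambda>n. 2 ^ n\<^sup>2)"
  unfolding super_exponential_def
proof (intro allI impI)
  fix c :: real assume "c > 1"
  then show "filterlim (\<lambda>n. 2 ^ n\<^sup>2 / c ^ n) at_top sequentially"
    by real_asymp
qed

section \<open>Relations generated by two rotating blocks and one edge\<close>

text \<open>The blocks are 0, ..., m - 1 and m, ..., 2m. Edges between them lead only from the first
  to the second, so no two of them ever compose and added edges merely accumulate.\<close>

definition rotation_automaton :: "nat \<Rightarrow> (nat, nat) automaton" where
  "rotation_automaton m =
     \<lparr>states = {..<2 * m + 1}, events = {0, 1},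
      trans = (\<lambda>q a.
        if a = 0 then (if q < m then {(q + 1) mod m} else {m + (q - m + 1) mod (m + 1)})
        else (if q = 0 then {0, m} else {q}))\<rparr>"

text \<open>The image of state \<open>s\<close> after \<open>k\<close> rotations when the edges
  \<open>S\<close> have been added. A pair \<open>(s, j)\<close> in \<open>S\<close> stands for the
  edge from \<open>s\<close> to \<open>m + j\<close> in positions before rotating, so a further
  rotation changes \<open>k\<close> alone.\<close>

definition row :: "nat \<Rightarrow> nat \<Rightarrow> (nat \<times> nat) set \<Rightarrow> nat \<Rightarrow> nat set" where
  "row m k S s =
     (if s < m then insert ((s + k) mod m) ((\<lambda>j. m + (j + k) mod (m + 1)) ` (S `` {s}))
      else {m + (s - m + k) mod (m + 1)})"

definition row_reachable :: "nat \<Rightarrow> nat \<Rightarrow> (nat \<times> nat) set \<Rightarrow> bool" where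
  "row_reachable m k S \<longleftrightarrow>
     (\<exists>w\<in>lists {0, 1}. \<forall>s<2 * m + 1. delta (rotation_automaton m) {s} w = row m k S s)"

lemma wf_rotation_automaton:
  assumes "m \<ge> 1"
  shows "wf_automaton (rotation_automaton m)"
proof -
  have "x mod m < 2 * m + 1" for x :: nat
    using mod_less_divisor[of m x] assms by linarith
  moreover have "m + x mod (m + 1) < 2 * m + 1" for x :: nat
    using mod_less_divisor[of "m + 1" x] by linarith
  ultimately show ?thesis
    using assms by (auto simp: wf_automaton_def rotation_automaton_def)
qed

lemma row_reachable_Suc:
  assumes "m \<ge> 1" "row_reachable m k S"
  shows "row_reachable m (Suc k) S"
proof -
  obtain w where w: "w \<in> lists {0, 1}"
    "\<forall>s<2 * m + 1. delta (rotation_automaton m) {s} w = row m k S s"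
    using assms(2) unfolding row_reachable_def by blast
  have step: "trans (rotation_automaton m) q 0 =
      (if q < m then {Suc q mod m} else {m + Suc (q - m) mod (m + 1)})" for q
    by (simp add: rotation_automaton_def)
  have "(\<Union>q\<in>row m k S s. trans (rotation_automaton m) q 0) = row m (Suc k) S s" for s
  proof (cases "s < m")
    case True
    then have "row m k S s = insert ((s + k) mod m) ((\<lambda>j. m + (j + k) mod (m + 1)) ` (S `` {s}))"
      by (simp add: row_def)
    also have "(\<Union>q\<in>\<dots>. trans (rotation_automaton m) q 0) =
        insert (Suc (s + k) mod m) ((\<lambda>j. m + Suc (j + k) mod (m + 1)) ` (S `` {s}))"
      using assms(1) by (auto simp: step mod_Suc_eq)
    also have "\<dots> = row m (Suc k) S s"
      using True by (simp add: row_def)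
    finally show ?thesis .
  next
    case False
    then show ?thesis
      by (simp add: row_def step mod_Suc_eq del: One_nat_def)
  qed
  with w show ?thesis
    unfolding row_reachable_def by (intro bexI[of _ "w @ [0]"]) (auto simp: delta_snoc)
qed

lemma row_reachable_le:
  assumes "m \<ge> 1" "row_reachable m k S" "k \<le> k'"
  shows "row_reachable m k' S"
  using assms(3)
proof (induction rule: dec_induct)
  case base
  show ?case by (rule assms(2))
next
  case (step i)
  then show ?case using row_reachable_Suc[OF assms(1)] by blast
qed

text \<open>The two congruences say that rotating by \<open>k\<close> has brought the endpoints of
  the edge \<open>(s, j)\<close> to the states 0 and \<open>m\<close>, which are those of the edge
  that event 1 adds.\<close>

lemma row_reachable_insert:
  assumes "row_reachable m k S" "s < m" "(s + k) mod m = 0" "(j + k) mod (m + 1) = 0"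
  shows "row_reachable m k (insert (s, j) S)"
proof -
  obtain w where w: "w \<in> lists {0, 1}"
    "\<forall>s<2 * m + 1. delta (rotation_automaton m) {s} w = row m k S s"
    using assms(1) unfolding row_reachable_def by blast
  \<comment> \<open>Rotation permutes the first block, so \<open>s\<close> is the only start state
    whose row contains 0, the one state at which event 1 branches.\<close>
  have eq: "(s' + k) mod m = 0 \<longleftrightarrow> s' = s" if "s' < m" for s'
  proof -
    have "(s' + k) mod m = 0 \<longleftrightarrow> [s' + k = s + k] (mod m)"
      unfolding Cong.cong_def assms(3) ..
    also have "\<dots> \<longleftrightarrow> s' = s"
      unfolding cong_add_rcancel_nat using that assms(2) by (simp add: Cong.cong_def)
    finally show ?thesis .
  qed
  have "(\<Union>q\<in>row m k S s'. trans (rotation_automaton m) q 1) = row m k (insert (s, j) S) s'" for s'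
  proof (cases "s' < m")
    case True
    have "(\<Union>q\<in>row m k S s'. trans (rotation_automaton m) q 1) =
        (if s' = s then insert m (row m k S s') else row m k S s')"
      using eq[OF True] True by (auto simp: row_def rotation_automaton_def split: if_splits)
    also have "\<dots> = row m k (insert (s, j) S) s'"
    proof (cases "s' = s")
      case True
      then have "insert (s, j) S `` {s'} = insert j (S `` {s'})" by auto
      then show ?thesis
        unfolding row_def using True assms(2,4) by (simp add: insert_commute)
    next
      case False
      then have "insert (s, j) S `` {s'} = S `` {s'}" by auto
      then show ?thesis unfolding row_def using False by presburger
    qed
    finally show ?thesis .
  next
    case False
    then show ?thesis using assms(2) by (auto simp: row_def rotation_automaton_def)
  qed
  with w show ?thesis
    unfolding row_reachable_def by (intro bexI[of _ "w @ [1]"]) (auto simp: delta_snoc)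
qed

lemma row_reachable_Nil:
  assumes "m \<ge> 1"
  shows "row_reachable m 0 {}"
proof -
  have "row m 0 {} s = {s}" if "s < 2 * m + 1" for s
    using that by (auto simp: row_def)
  then show ?thesis
    unfolding row_reachable_def by (intro bexI[of _ "[]"]) auto
qed

text \<open>Appending rotations can only increase the count \<open>k\<close>, so a solution above a
  given bound is required; adding a multiple of \<open>a * b\<close> to any solution provides
  it.\<close>

lemma chinese_remainder_ge:
  fixes a b :: nat
  assumes "coprime a b" "a > 0" "b > 0"
  shows "\<exists>x\<ge>k. [x = u] (mod a) \<and> [x = v] (mod b)"
proof -
  obtain x where x: "[x = u] (mod a)" "[x = v] (mod b)"
    using binary_chinese_remainder_nat[OF assms(1)] by blast
  have "k \<le> x + k * (a * b)" using assms(2,3) by (simp add: trans_le_add2)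
  moreover have "(x + k * (a * b)) mod a = x mod a" "(x + k * (a * b)) mod b = x mod b"
    by (metis mod_mult_self2 mult.assoc mult.commute)+
  ultimately show ?thesis using x unfolding Cong.cong_def by metis
qed

text \<open>Edges are added one at a time: rotate until the next edge lies over the edge of event 1,
  then apply that event. Earlier edges survive since rotating leaves \<open>S\<close>
  unchanged.\<close>

lemma row_reachable_some:
  assumes "m \<ge> 1" "S \<subseteq> {..<m} \<times> {..<m + 1}"
  shows "\<exists>k. row_reachable m k S"
proof -
  have "finite S" using assms(2) by (rule finite_subset) simp
  then show ?thesis using assms(2)
  proof (induction S rule: finite_induct)
    case empty
    then show ?case using row_reachable_Nil[OF assms(1)] by blast
  next
    case (insert p S)
    obtain s j where p: "p = (s, j)" "s < m" "j < m + 1" using insert.prems by auto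
    obtain k where k: "row_reachable m k S" using insert by blast
    \<comment> \<open>These residues are -s and -j, written as natural numbers, so that
      \<open>s + t\<close> and \<open>j + t\<close> vanish modulo the block sizes.\<close>
    obtain t where t: "t \<ge> k" "[t = m - s] (mod m)" "[t = m + 1 - j] (mod (m + 1))"
      using chinese_remainder_ge[of m "m + 1" k] assms(1) by auto
    have "[s + t = s + (m - s)] (mod m)" "[j + t = j + (m + 1 - j)] (mod (m + 1))"
      using t by (simp_all only: cong_add_lcancel_nat)
    then have "(s + t) mod m = 0" "(j + t) mod (m + 1) = 0"
      using p by (simp_all add: Cong.cong_def)
    with row_reachable_le[OF assms(1) k t(1)] p(2) have "row_reachable m t (insert (s, j) S)"
      by (rule row_reachable_insert)
    then show ?case using p(1) by blast
  qed
qed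

lemma row_cong:
  assumes "[k = l] (mod m)" "[k = l] (mod (m + 1))"
  shows "row m k S = row m l S"
proof -
  have "(x + k) mod m = (x + l) mod m" "(x + k) mod (m + 1) = (x + l) mod (m + 1)" for x
    using assms by (metis cong_add_lcancel_nat Cong.cong_def)+
  then show ?thesis unfolding row_def by presburger
qed

text \<open>Once \<open>S\<close> is obtained with some count \<open>l\<close>, rotate on to a count
  \<open>t\<close> that agrees with \<open>k\<close> modulo both block sizes; \<open>row\<close>
  cannot tell \<open>t\<close> from \<open>k\<close>.\<close>

lemma row_reachable_all:
  assumes "m \<ge> 1" "S \<subseteq> {..<m} \<times> {..<m + 1}"
  shows "row_reachable m k S"
proof -
  obtain l where l: "row_reachable m l S" using row_reachable_some[OF assms] by blast
  obtain t where t: "t \<ge> l" "[t = k] (mod m)" "[t = k] (mod (m + 1))"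
    using chinese_remainder_ge[of m "m + 1" l k k] assms(1) by auto
  then show ?thesis
    using row_reachable_le[OF assms(1) l t(1)] row_cong[OF t(2,3)]
    by (simp add: row_reachable_def)
qed

section \<open>Counting the relations reached\<close>

lemma row_inj:
  assumes m: "m \<ge> 1" and "S \<subseteq> {..<m} \<times> {..<m + 1}" "S' \<subseteq> {..<m} \<times> {..<m + 1}"
    and "k < m * (m + 1)" "k' < m * (m + 1)"
    and eq: "\<And>s. s < 2 * m + 1 \<Longrightarrow> row m k S s = row m k' S' s"
  shows "k = k' \<and> S = S'"
proof -
  \<comment> \<open>Edges contribute only states from \<open>m\<close> on, so the part of a row
    inside the first block reveals \<open>k\<close> modulo \<open>m\<close>.\<close>
  have low: "row m k S s \<inter> {..<m} = {(s + k) mod m}" if "s < m" for k S s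
    using that by (auto simp: row_def)
  have "{(0 + k) mod m} = {(0 + k') mod m}"
    using low[of 0 k S] low[of 0 k' S'] eq[of 0] m by simp
  then have "[k = k'] (mod m)" by (simp add: Cong.cong_def)
  \<comment> \<open>Row \<open>m\<close> belongs to the first state of the second block and is the
    singleton of \<open>m + k mod (m + 1)\<close>.\<close>
  moreover have "[k = k'] (mod (m + 1))"
    using eq[of m] by (simp add: row_def Cong.cong_def)
  ultimately have "[k = k'] (mod (m * (m + 1)))"
    by (intro coprime_cong_mult_nat) auto
  then have k: "k = k'" using assms(4,5) by (simp add: Cong.cong_def)
  \<comment> \<open>With \<open>k\<close> known, \<open>S\<close> can be read off the part of each
    row in the second block, because rotation by \<open>k\<close> is injective on remainders modulo
    \<open>m + 1\<close>.\<close>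
  have up: "(s, j) \<in> S \<longleftrightarrow> m + (j + k) mod (m + 1) \<in> row m k S s"
    if "s < m" "j < m + 1" "S \<subseteq> {..<m} \<times> {..<m + 1}" for s j S
  proof
    assume "m + (j + k) mod (m + 1) \<in> row m k S s"
    moreover have "(s + k) mod m < m" using m by simp
    ultimately have "m + (j + k) mod (m + 1) \<in> (\<lambda>i. m + (i + k) mod (m + 1)) ` (S `` {s})"
      using that(1) unfolding row_def by (metis insertE not_add_less1)
    then obtain i where i: "(s, i) \<in> S" "(j + k) mod (m + 1) = (i + k) mod (m + 1)"
      by (elim imageE) simp
    then have "[j = i] (mod (m + 1))"
      by (metis cong_add_rcancel_nat Cong.cong_def)
    moreover have "i < m + 1" using i that(3) by auto
    ultimately have "j = i" using that(2) by (simp add: Cong.cong_def)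
    with i show "(s, j) \<in> S" by simp
  qed (use that in \<open>auto simp: row_def\<close>)
  have "(s, j) \<in> S \<longleftrightarrow> (s, j) \<in> S'" for s j
  proof (cases "s < m \<and> j < m + 1")
    case True
    then show ?thesis using up[of s j S] up[of s j S'] assms(2,3) eq[of s] k by simp
  next
    case False
    then show ?thesis using assms(2,3) by blast
  qed
  with k show ?thesis by auto
qed

text \<open>Each of the m (m + 1) rotation counts is paired with each of the 2^(m (m + 1)) edge
  sets; all these pairs give reachable relations, and different pairs give different ones.\<close>

lemma card_word_relation_rotation_ge:
  assumes m: "m \<ge> 1"
  shows "m * (m + 1) * 2 ^ (m * (m + 1)) \<le>
    card (word_relation (rotation_automaton m) ` lists (events (rotation_automaton m)))"
proof -
  let ?A = "rotation_automaton m"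
  let ?D = "{..<m * (m + 1)} \<times> Pow ({..<m} \<times> {..<m + 1})"
  let ?f = "\<lambda>(k, S). SIGMA s:{..<2 * m + 1}. row m k S s"
  let ?W = "word_relation ?A ` lists (events ?A)"
  have AA: "states ?A = {..<2 * m + 1}" "events ?A = {0, 1}"
    by (simp_all add: rotation_automaton_def)
  have "inj_on ?f ?D"
  proof (rule inj_onI)
    fix x y assume xy: "x \<in> ?D" "y \<in> ?D" "?f x = ?f y"
    obtain k S l T where x: "x = (k, S)" and y: "y = (l, T)" by (cases x, cases y)
    have "row m k S s = row m l T s" if "s < 2 * m + 1" for s
    proof -
      have "row m k S s = ?f x `` {s}" "row m l T s = ?f y `` {s}"
        unfolding x y using that by auto
      then show ?thesis using xy(3) by simp
    qed
    then show "x = y" using row_inj[OF m, of S T k l] xy(1,2) x y by simp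
  qed
  moreover have "?f ` ?D \<subseteq> ?W"
  proof
    fix r assume "r \<in> ?f ` ?D"
    then obtain k S where S: "S \<subseteq> {..<m} \<times> {..<m + 1}" "r = ?f (k, S)" by auto
    obtain w where "w \<in> lists {0, 1}" "\<forall>s<2 * m + 1. delta ?A {s} w = row m k S s"
      using row_reachable_all[OF m S(1), of k] unfolding row_reachable_def by blast
    then have "word_relation ?A w = r" "w \<in> lists (events ?A)"
      unfolding word_relation_def AA S(2) by (auto intro!: Sigma_cong)
    then show "r \<in> ?W" by blast
  qed
  \<comment> \<open>An infinite set would have \<open>card\<close> 0, so the comparison of
    cardinalities requires finiteness.\<close>
  moreover have "finite ?W"
  proof (rule finite_subset)
    show "?W \<subseteq> Pow (states ?A \<times> states ?A)"
      using word_relation_subset[OF wf_rotation_automaton[OF m]] by blast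
  qed (simp add: AA)
  ultimately have "card ?D \<le> card ?W" by (rule card_inj_on_le)
  then show ?thesis by (simp add: card_cartesian_product card_Pow)
qed

section \<open>Lower bounds on the number of steps\<close>

lemma worst_case_steps_binary_ge:
  fixes run :: "(nat, nat) alg2_input \<Rightarrow> bool \<times> nat"
  assumes "executes_alg2 run" "m \<ge> 1"
  shows "ereal (real (m * (m + 1) * 2 ^ (m * (m + 1)))) \<le>
    worst_case_steps run (binary_inputs (2 * m + 1))"
proof -
  let ?A = "rotation_automaton m"
  \<comment> \<open>The bound comes from the observer, which is built from the nonsecret clusters,
    so the secret set is taken to be empty.\<close>
  let ?x = "(?A, {}, full_clusters ?A, events ?A)"
  note wf = wf_rotation_automaton[OF assms(2)]
  have "?x \<in> alg2_inputs"
    using wf clustered_form_full[of ?A] clustered_form_empty[of ?A]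
    by (auto simp: alg2_inputs_def)
  moreover have "card (states ?A) = 2 * m + 1" "card (events ?A) = 2"
    by (simp_all add: rotation_automaton_def)
  ultimately have x: "?x \<in> binary_inputs (2 * m + 1)"
    unfolding binary_inputs_def by simp
  have "m * (m + 1) * 2 ^ (m * (m + 1)) \<le> snd (run ?x)"
    using card_word_relation_rotation_ge[OF assms(2)] card_dstates_observer_full[OF wf]
      executes_alg2_ge_observer[OF assms(1) wf order_refl clustered_form_empty clustered_form_full]
    by linarith
  then have "ereal (real (m * (m + 1) * 2 ^ (m * (m + 1)))) \<le> ereal (real (snd (run ?x)))"
    by (simp only: ereal_less_eq of_nat_le_iff)
  also have "\<dots> \<le> worst_case_steps run (binary_inputs (2 * m + 1))"
    unfolding worst_case_steps_def using x by (rule SUP_upper)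
  finally show ?thesis .
qed

theorem mainTheorem5:
  "(\<exists>(A :: nat \<Rightarrow> (nat, nat) automaton) QNS CNS Sigma_o.
      super_exponential (\<lambda>n. real (card (events (A n)))) \<and>
      (\<forall>n\<ge>1.
         wf_automaton (A n) \<and> card (states (A n)) = n \<and>
         Sigma_o n \<subseteq> events (A n) \<and> clustered_form (A n) (QNS n) (CNS n) \<and>
         card (dstates (observer (cluster_nfa (A n) (CNS n)) (Sigma_o n))) = 2 ^ n\<^sup>2 \<and>
         (\<forall>run QS CS. executes_alg2 run \<and> clustered_form (A n) QS CS \<longrightarrow>
            2 ^ n\<^sup>2 \<le> snd (run (A n, CS, CNS n, Sigma_o n))))) \<and>
   (\<forall>run :: (nat, nat) alg2_input \<Rightarrow> bool \<times> nat. executes_alg2 run \<longrightarrow>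
      (\<exists>c>0. \<forall>\<^sub>F n in sequentially. odd n \<longrightarrow>
         ereal (c * real n ^ 2 * 2 powr ((real n ^ 2 - 1) / 4))
           \<le> worst_case_steps run (binary_inputs n)))"
proof (intro conjI allI impI)
  \<comment> \<open>The construction also covers n = 0, with no state and a single event, so one
    sequence can be chosen for all \<open>n\<close>.\<close>
  obtain A :: "nat \<Rightarrow> (nat, nat) automaton" where A:
    "\<And>n. card (events (A n)) = 2 ^ n\<^sup>2" "\<And>n. wf_automaton (A n)" "\<And>n. card (states (A n)) = n"
    "\<And>n. card (word_relation (A n) ` lists (events (A n))) = 2 ^ n\<^sup>2"
    using exists_full_relation_automaton by metis
  have obs: "card (dstates (observer (cluster_nfa (A n) (full_clusters (A n))) (events (A n)))) = 2 ^ n\<^sup>2"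
    for n
    using card_dstates_observer_full[OF A(2)] A(4) by simp
  have steps: "2 ^ n\<^sup>2 \<le> snd (run (A n, CS, full_clusters (A n), events (A n)))"
    if "executes_alg2 run" "clustered_form (A n) QS CS" for n run QS CS
    using executes_alg2_ge_observer[OF that(1) A(2) order_refl that(2) clustered_form_full] obs[of n]
    by simp
  show "\<exists>(A :: nat \<Rightarrow> (nat, nat) automaton) QNS CNS Sigma_o.
      super_exponential (\<lambda>n. real (card (events (A n)))) \<and>
      (\<forall>n\<ge>1.
         wf_automaton (A n) \<and> card (states (A n)) = n \<and>
         Sigma_o n \<subseteq> events (A n) \<and> clustered_form (A n) (QNS n) (CNS n) \<and>
         card (dstates (observer (cluster_nfa (A n) (CNS n)) (Sigma_o n))) = 2 ^ n\<^sup>2 \<and>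
         (\<forall>run QS CS. executes_alg2 run \<and> clustered_form (A n) QS CS \<longrightarrow>
            2 ^ n\<^sup>2 \<le> snd (run (A n, CS, CNS n, Sigma_o n))))"
  proof (rule exI[of _ A], rule exI[of _ "\<lambda>n. states (A n) \<times> states (A n)"],
      rule exI[of _ "\<lambda>n. full_clusters (A n)"], rule exI[of _ "\<lambda>n. events (A n)"],
      intro conjI allI impI)
    show "super_exponential (\<lambda>n. real (card (events (A n))))"
      using super_exponential_two_power_square by (simp add: A(1))
  next
    fix n
    show "wf_automaton (A n)" by (rule A(2))
    show "card (states (A n)) = n" by (rule A(3))
    show "clustered_form (A n) (states (A n) \<times> states (A n)) (full_clusters (A n))"
      by (rule clustered_form_full)
    show "card (dstates (observer (cluster_nfa (A n) (full_clusters (A n))) (events (A n)))) = 2 ^ n\<^sup>2"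
      by (rule obs)
  next
    fix n QS CS and run :: "(nat, nat) alg2_input \<Rightarrow> bool \<times> nat"
    assume "executes_alg2 run \<and> clustered_form (A n) QS CS"
    then show "2 ^ n\<^sup>2 \<le> snd (run (A n, CS, full_clusters (A n), events (A n)))"
      using steps by blast
  qed simp
next
  fix run :: "(nat, nat) alg2_input \<Rightarrow> bool \<times> nat"
  assume run: "executes_alg2 run"
  \<comment> \<open>Odd n \<ge> 3 means n = 2m + 1 with m \<ge> 1, so that the first block is
    nonempty.\<close>
  have "ereal (1 / 8 * real n ^ 2 * 2 powr ((real n ^ 2 - 1) / 4))
           \<le> worst_case_steps run (binary_inputs n)" if n: "n \<ge> 3" "odd n" for n
  proof -
    obtain m where m: "n = 2 * m + 1" using n(2) by (rule oddE)
    then have m1: "m \<ge> 1" using n(1) by simp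
    have e: "(real n ^ 2 - 1) / 4 = real (m * (m + 1))"
      unfolding m by (simp add: power2_eq_square algebra_simps)
    \<comment> \<open>For n = 2m + 1 the factor 1/8 asks for 4m^2 + 4m + 1 \<le> 8m^2 + 8m, which
      follows from this bound.\<close>
    have "1 \<le> real m ^ 2" using m1 by simp
    then have "1 / 8 * real n ^ 2 \<le> real (m * (m + 1))"
      unfolding m by (simp add: power2_eq_square algebra_simps)
    then have "1 / 8 * real n ^ 2 * 2 powr ((real n ^ 2 - 1) / 4) \<le>
        real (m * (m + 1)) * 2 powr real (m * (m + 1))"
      unfolding e by (rule mult_right_mono) simp
    also have "\<dots> = real (m * (m + 1) * 2 ^ (m * (m + 1)))"
      by (subst powr_realpow) simp_all
    finally have "ereal (1 / 8 * real n ^ 2 * 2 powr ((real n ^ 2 - 1) / 4)) \<le>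
        ereal (real (m * (m + 1) * 2 ^ (m * (m + 1))))"
      by (simp only: ereal_less_eq)
    also have "\<dots> \<le> worst_case_steps run (binary_inputs n)"
      unfolding m by (rule worst_case_steps_binary_ge[OF run m1])
    finally show ?thesis .
  qed
  then have "\<forall>\<^sub>F n in sequentially. odd n \<longrightarrow>
      ereal (1 / 8 * real n ^ 2 * 2 powr ((real n ^ 2 - 1) / 4))
        \<le> worst_case_steps run (binary_inputs n)"
    unfolding eventually_sequentially by blast
  then show "\<exists>c>0. \<forall>\<^sub>F n in sequentially. odd n \<longrightarrow>
      ereal (c * real n ^ 2 * 2 powr ((real n ^ 2 - 1) / 4))
        \<le> worst_case_steps run (binary_inputs n)"
    by (intro exI[of _ "1 / 8"]) simp
qed

end
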